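(* Let $\mathcal{D}_{\mathcal{E}}$ be an unknown probability distribution over environments, let $E_1,\dots,E_N$ be i.i.d. samples from $\mathcal{D}_{\mathcal{E}}$ (the calibration dataset), with non-conformity scores $U_1,\dots,U_N$, and let $\epsilon,\delta\in(0,1)$. Let $\hat\epsilon$ be a calibration threshold such that, with $v:=\lfloor (N+1)\hat\epsilon\rfloor$ (where $1\le v\le N$), one has $\mathrm{Beta}^{-1}_{N+1-v,\,v}(\delta)\ge 1-\epsilon$, and let $\hat q_{1-\epsilon}$ be the corresponding empirical quantile, i.e. the $\lceil (N+1)(1-\hat\epsilon)\rceil$-th smallest of $U_1,\dots,U_N$. Consider the calibrated perception system $\tilde\phi$ that modifies every output of the perception system $\phi$ by replacing the predicted occupied space in environment $E$ from state $s$ by the scaled predicted occupied space $\overline{\mathcal{X}}^{\mathrm{occ}}_{s,E}(\hat q_{1-\epsilon})$. Then, with probability at least $1-\delta$ over the sampling of the calibration dataset, $\tilde\phi$ has an $\epsilon$-bounded misdetection rate on a new test environment $E_{\mathrm{test}}\sim\mathcal{D}_{\mathcal{E}}$ (drawn independently of the calibration dataset): $$\mathbb{E}_{E_{\mathrm{test}}\sim\mathcal{D}_{\mathcal{E}}}\big[\tilde C_{E_{\mathrm{test}}}(\tilde\phi)\,\big|\,U_1,\dots,U_N\big]\le\epsilon .$$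
   Context: Setting. $\mathcal{S}$ is a finite, discrete set of robot states. Each environment $E$ has a configuration space $\mathcal{X}_E$ and a ground-truth occupied space $\mathcal{X}^{\mathrm{occ}}_E\subseteq\mathcal{X}_E$. A pre-trained perception system $\phi$ produces, for each environment $E$ and each state $s\in\mathcal{S}$, a predicted occupied space. This prediction can be scaled by a real parameter $q$, giving sets $\overline{\mathcal{X}}^{\mathrm{occ}}_{s,E}(q)\subseteq\mathcal{X}_E$ that expand monotonically: $q\le q'$ implies $\overline{\mathcal{X}}^{\mathrm{occ}}_{s,E}(q)\subseteq\overline{\mathcal{X}}^{\mathrm{occ}}_{s,E}(q')$. Non-conformity score. For an environment $E$, $$U_E:=\min\{q:\ \mathcal{X}^{\mathrm{occ}}_E\subseteq\overline{\mathcal{X}}^{\mathrm{occ}}_{s,E}(q)\ \ \forall s\in\mathcal{S}\},$$ the minimum being assumed to exist; $U_E$ is a (measurable) real random variable when $E\sim\mathcal{D}_{\mathcal{E}}$. Write $U_i:=U_{E_i}$. Misdetection cost. For a perception system $\psi$ whose predicted occupied space in $E$ from state $s$ is $\overline{\mathcal{X}}^{\mathrm{occ}}_{s,E}$, define $$\tilde C_E(\psi):=\max_{s\in\mathcal{S}}\ \mathbb{1}\big[\mathcal{X}^{\mathrm{occ}}_E\not\subseteq\overline{\mathcal{X}}^{\mathrm{occ}}_{s,E}\big]\in\{0,1\}.$$ Notation. $\mathrm{Beta}^{-1}_{a,b}(\delta)$ is the $\delta$-quantile of the Beta distribution with parameters $a$ and $b$. Note that $\lceil (N+1)(1-\hat\epsilon)\rceil=N+1-v$.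 *)

theory Defs
  imports "HOL-Probability.Probability"
begin

text \<open>
  A perception system maps a robot state and an environment to the predicted occupied space.
  A scalable one takes the scaling parameter as an additional last argument.
\<close>

type_synonym ('s, 'e, 'x) perception = "'s \<Rightarrow> 'e \<Rightarrow> 'x set"
type_synonym ('s, 'e, 'x) scaled_perception = "'s \<Rightarrow> 'e \<Rightarrow> real \<Rightarrow> 'x set"

definition has_minimum :: "real set \<Rightarrow> bool" where
  "has_minimum A \<longleftrightarrow> (\<exists>m\<in>A. \<forall>q\<in>A. m \<le> q)"

definition covering_scales ::
    "'s set \<Rightarrow> ('e \<Rightarrow> 'x set) \<Rightarrow> ('s, 'e, 'x) scaled_perception \<Rightarrow> 'e \<Rightarrow> real set" where
  "covering_scales S occ pred E = {q. \<forall>s\<in>S. occ E \<subseteq> pred s E q}"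

text \<open>
  \<open>LEAST\<close> on the reals is meaningful only where the minimum exists, so users of this definition
  have to assume \<open>has_minimum (covering_scales S occ pred E)\<close>.
\<close>

definition nonconformity_score ::
    "'s set \<Rightarrow> ('e \<Rightarrow> 'x set) \<Rightarrow> ('s, 'e, 'x) scaled_perception \<Rightarrow> 'e \<Rightarrow> real" where
  "nonconformity_score S occ pred E = (LEAST q. q \<in> covering_scales S occ pred E)"

text \<open>
  The maximum is over a nonempty set whenever \<open>covering_scales S occ pred E\<close> has a minimum for
  some \<open>pred\<close>, since for empty \<open>S\<close> that set is all of the reals.
\<close>

definition misdetection_cost ::
    "'s set \<Rightarrow> ('e \<Rightarrow> 'x set) \<Rightarrow> ('s, 'e, 'x) perception \<Rightarrow> 'e \<Rightarrow> real" where
  "misdetection_cost S occ \<psi> E = Max ((\<lambda>s. of_bool (\<not> occ E \<subseteq> \<psi> s E)) ` S)"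

definition calibrated ::
    "('s, 'e, 'x) scaled_perception \<Rightarrow> real \<Rightarrow> ('s, 'e, 'x) perception" where
  "calibrated pred q = (\<lambda>s E. pred s E q)"

text \<open>The \<open>k\<close>-th smallest of \<open>u 1, \<dots>, u N\<close>, counted with multiplicity, for \<open>1 \<le> k \<le> N\<close>.\<close>

definition kth_smallest :: "nat \<Rightarrow> nat \<Rightarrow> (nat \<Rightarrow> real) \<Rightarrow> real" where
  "kth_smallest N k u = sort (map u [1..<Suc N]) ! (k - 1)"

definition beta_density :: "real \<Rightarrow> real \<Rightarrow> real \<Rightarrow> real" where
  "beta_density a b x =
     (if 0 < x \<and> x < 1 then x powr (a - 1) * (1 - x) powr (b - 1) / Beta a b else 0)"

definition beta_distribution :: "real \<Rightarrow> real \<Rightarrow> real measure" where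
  "beta_distribution a b = density lborel (\<lambda>x. ennreal (beta_density a b x))"

definition quantile :: "real measure \<Rightarrow> real \<Rightarrow> real" where
  "quantile M p = Inf {x. p \<le> cdf M x}"

text \<open>The sigma-algebra on \<open>space M\<close> generated by the real random variables \<open>Z i\<close>, \<open>i \<in> I\<close>.\<close>

definition generated_algebra :: "'w measure \<Rightarrow> 'i set \<Rightarrow> ('i \<Rightarrow> 'w \<Rightarrow> real) \<Rightarrow> 'w measure" where
  "generated_algebra M I Z =
     vimage_algebra (space M) (\<lambda>\<omega>. \<lambda>i\<in>I. Z i \<omega>) (\<Pi>\<^sub>M i\<in>I. borel)"

end

theory Submission
  imports Defs
begin

text \<open>
  The calibrated system errs in \<open>e\<close> exactly when \<open>U e\<close> exceeds the empirical quantile \<open>q\<close>, so by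
  independence its misdetection rate given the scores is \<open>1 - F q\<close>, where \<open>F\<close> is the distribution
  function of the score. As \<open>q\<close> is the \<open>k\<close>-th smallest score with \<open>k = N + 1 - v\<close>, the event
  \<open>F q < 1 - \<epsilon>\<close> means that at least \<open>k\<close> of the i.i.d. events \<open>F (U\<^sub>i) < 1 - \<epsilon>\<close> occur. Each of them
  has probability at most \<open>1 - \<epsilon>\<close>, even when \<open>F\<close> has jumps, so this is bounded by a binomial tail
  at \<open>1 - \<epsilon>\<close>, which equals the distribution function of the Beta distribution with parameters
  \<open>k\<close> and \<open>N + 1 - k\<close> at \<open>1 - \<epsilon>\<close>, and is at most \<open>\<delta>\<close> by the assumption on the quantile.
\<close>

section \<open>Order statistics through counting\<close>

text \<open>In the sorted list the entries satisfying a downward closed \<open>P\<close> form an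
  initial segment, whose length is the count on the right. \<open>P\<close> is kept general because
  it is used both for closed rays \<open>x \<le> a\<close> and for \<open>cdf L x < p\<close>, whose
  ray may be open or closed.\<close>

lemma kth_smallest_iff_card:
  assumes down: "\<And>x y. x \<le> y \<Longrightarrow> P y \<Longrightarrow> P x" and k: "1 \<le> k" "k \<le> N"
  shows "P (kth_smallest N k u) \<longleftrightarrow> k \<le> card {i\<in>{1..N}. P (u i)}"
proof -
  define xs where "xs = sort (map u [1..<Suc N])"
  have len: "length xs = N" and srt: "sorted xs" by (simp_all add: xs_def)
  have "card {i. i < N \<and> P (xs ! i)} = length (filter P xs)"
    by (simp add: length_filter_conv_card len)
  also have "\<dots> = length (filter (\<lambda>i. P (u i)) [1..<Suc N])"
    by (simp add: xs_def filter_sort filter_map comp_def del: upt_Suc)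
  also have "\<dots> = card {i\<in>{1..N}. P (u i)}"
    by (subst distinct_card[symmetric]) (auto intro!: arg_cong[where f = card])
  finally have card: "card {i. i < N \<and> P (xs ! i)} = card {i\<in>{1..N}. P (u i)}" .
  have mono: "xs ! i \<le> xs ! j" if "i \<le> j" "j < N" for i j
    using sorted_nth_mono[OF srt] that len by simp
  have "P (xs ! (k - 1)) \<longleftrightarrow> k \<le> card {i. i < N \<and> P (xs ! i)}"
  proof
    assume "P (xs ! (k - 1))"
    then have "{..<k} \<subseteq> {i. i < N \<and> P (xs ! i)}"
      using k by (auto intro: down[OF mono[of _ "k - 1"]])
    from card_mono[OF _ this] show "k \<le> card {i. i < N \<and> P (xs ! i)}" by simp
  next
    assume le: "k \<le> card {i. i < N \<and> P (xs ! i)}"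
    show "P (xs ! (k - 1))"
    proof (rule ccontr)
      assume "\<not> P (xs ! (k - 1))"
      then have "{i. i < N \<and> P (xs ! i)} \<subseteq> {..<k - 1}"
        using down[OF mono[of "k - 1"]] by (auto simp: not_less[symmetric])
      from card_mono[OF _ this] show False using le k by simp
    qed
  qed
  then show ?thesis by (simp only: card kth_smallest_def xs_def[symmetric])
qed

section \<open>Binomial tails and the Beta distribution\<close>

definition binomial_tail :: "nat \<Rightarrow> nat \<Rightarrow> real \<Rightarrow> real" where
  "binomial_tail n k p = (\<Sum>j=k..n. real (n choose j) * p ^ j * (1 - p) ^ (n - j))"

text \<open>The derivative of the sum telescopes: the negative part from the term \<open>j\<close>
  cancels the positive part from the term \<open>j + 1\<close>, so only the positive part of the
  first term survives. The induction runs downwards from \<open>k = n\<close>.\<close>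

lemma DERIV_binomial_tail:
  assumes "1 \<le> k" "k \<le> n"
  shows "(binomial_tail n k has_real_derivative
           real k * real (n choose k) * p ^ (k - 1) * (1 - p) ^ (n - k)) (at p)"
  using assms(2,1)
proof (induction k rule: inc_induct)
  case base
  show ?case unfolding binomial_tail_def by (auto intro!: derivative_eq_intros)
next
  case (step k)
  have split: "binomial_tail n k =
      (\<lambda>p. real (n choose k) * p ^ k * (1 - p) ^ (n - k) + binomial_tail n (Suc k) p)"
    using step.hyps by (auto simp: binomial_tail_def sum.atLeast_Suc_atMost)
  \<comment> \<open>Rewrites the coefficient supplied by the induction hypothesis into that of the
    negative part of the new term, so that the two cancel.\<close>
  have absorb: "real (Suc k) * real (n choose Suc k) = real (n - k) * real (n choose k)"
    by (metis binomial_absorb_comp binomial_absorption mult.commute of_nat_mult)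
  have "((\<lambda>p. real (n choose k) * p ^ k * (1 - p) ^ (n - k)) has_real_derivative
      real (n choose k) * (real k * p ^ (k - 1)) * (1 - p) ^ (n - k)
       - real (n - k) * real (n choose k) * p ^ k * (1 - p) ^ (n - Suc k)) (at p)"
    by (auto intro!: derivative_eq_intros simp: algebra_simps)
  from DERIV_add[OF this step.IH] show ?case
    unfolding split absorb by (simp add: mult_ac)
qed

lemma binomial_tail_mono:
  assumes "1 \<le> k" "k \<le> n" "0 \<le> p" "p \<le> q" "q \<le> 1"
  shows "binomial_tail n k p \<le> binomial_tail n k q"
  using assms(4)
proof (rule DERIV_nonneg_imp_nondecreasing)
  fix x assume "p \<le> x" "x \<le> q"
  then show "\<exists>y. (binomial_tail n k has_real_derivative y) (at x) \<and> 0 \<le> y"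
    using assms by (intro exI[of _ "real k * real (n choose k) * x ^ (k - 1) * (1 - x) ^ (n - k)"]
        conjI DERIV_binomial_tail) auto
qed

text \<open>Gamma values at positive integers are factorials. The identity matches the normalising
  constant of the Beta density with the constant in the derivative of the binomial tail.\<close>

lemma inverse_Beta_binomial:
  assumes "1 \<le> k" "k \<le> n"
  shows "1 / Beta (real k) (real (n + 1 - k)) = real k * real (n choose k)"
proof -
  have G: "Gamma (real (m + 1)) = fact m" for m
    using Gamma_fact[of m, where 'a = real] by (simp add: add.commute)
  obtain j where k: "k = j + 1" using assms by (metis add.commute le_Suc_ex plus_1_eq_Suc)
  have nk: "n + 1 - k = (n - k) + 1" using assms by simp
  have "Gamma (real k) = fact j" "Gamma (real (n + 1 - k)) = fact (n - k)"
      "Gamma (real k + real (n + 1 - k)) = fact n"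
    using G[of j] G[of "n - k"] G[of n] assms unfolding nk k by (simp_all add: of_nat_diff)
  then show ?thesis
    unfolding Beta_def binomial_fact[OF assms(2), where 'a = real] by (simp add: k)
qed

text \<open>The density vanishes off the open unit interval. This bounds below the set whose infimum
  defines \<open>quantile\<close>.\<close>

lemma cdf_beta_distribution_nonpos:
  assumes "x \<le> 0"
  shows "cdf (beta_distribution a b) x = 0"
proof -
  have "emeasure (beta_distribution a b) {..x}
      = (\<integral>\<^sup>+t. ennreal (beta_density a b t) * indicator {..x} t \<partial>lborel)"
    unfolding beta_distribution_def
    by (subst emeasure_density) (auto simp: beta_density_def[abs_def])
  also have "\<dots> = (\<integral>\<^sup>+(t::real). 0 \<partial>lborel)"
    using assms by (intro nn_integral_cong) (auto simp: beta_density_def indicator_def)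
  finally show ?thesis by (simp add: cdf_def measure_def)
qed

text \<open>The Beta density is the derivative of the binomial tail, which is 0 at 0 because
  \<open>k\<close> is positive; the fundamental theorem of calculus does the rest.\<close>

lemma cdf_beta_distribution_eq_binomial_tail:
  assumes k: "1 \<le> k" "k \<le> n" and x: "0 \<le> x" "x < 1"
  shows "cdf (beta_distribution (real k) (real (n + 1 - k))) x = binomial_tail n k x"
proof -
  define f where "f t = real k * real (n choose k) * t ^ (k - 1) * (1 - t) ^ (n - k)" for t :: real
  have dens: "beta_density (real k) (real (n + 1 - k)) t = f t" if "0 < t" "t < 1" for t
  proof -
    have "t powr (real k - 1) = t ^ (k - 1)" "(1 - t) powr (real (n + 1 - k) - 1) = (1 - t) ^ (n - k)"
      using that k by (simp_all add: powr_realpow[symmetric] of_nat_diff)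
    then show ?thesis
      using that inverse_Beta_binomial[OF k]
      by (simp add: beta_density_def f_def divide_inverse mult_ac)
  qed
  have "emeasure (beta_distribution (real k) (real (n + 1 - k))) {..x}
      = (\<integral>\<^sup>+t. ennreal (beta_density (real k) (real (n + 1 - k)) t) * indicator {..x} t \<partial>lborel)"
    unfolding beta_distribution_def
    by (subst emeasure_density) (auto simp: beta_density_def[abs_def])
  also have "\<dots> = (\<integral>\<^sup>+t. ennreal (f t) * indicator {0..x} t \<partial>lborel)"
  proof (rule nn_integral_cong_AE)
    \<comment> \<open>At \<open>t = 0\<close> the Beta density is 0 by definition, whereas
      \<open>f 0\<close> equals \<open>n\<close> when \<open>k = 1\<close>; the integrands agree
      only off this null set.\<close>
    have "AE t in lborel. t \<noteq> (0::real)" by (rule AE_lborel_singleton)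
    then show "AE t in lborel. ennreal (beta_density (real k) (real (n + 1 - k)) t) * indicator {..x} t
        = ennreal (f t) * indicator {0..x} t"
    proof (eventually_elim)
      case (elim t)
      then show ?case
        using dens[of t] x by (cases "t < 0") (auto simp: indicator_def beta_density_def)
    qed
  qed
  also have "\<dots> = ennreal (binomial_tail n k x - binomial_tail n k 0)"
  proof (rule nn_integral_FTC_Icc)
    show "f \<in> borel_measurable borel" unfolding f_def by measurable
    fix t assume t: "t \<in> {0..x}"
    show "(binomial_tail n k has_real_derivative f t) (at t)"
      using DERIV_binomial_tail[OF k, of t]
      by (simp add: f_def)
    show "0 \<le> f t" using t x by (simp add: f_def)
  qed (use x in auto)
  also have "binomial_tail n k 0 = 0"
    using k by (auto simp: binomial_tail_def intro!: sum.neutral)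
  finally show ?thesis
    using binomial_tail_mono[OF k, of 0 x] x \<open>binomial_tail n k 0 = 0\<close>
    by (simp add: cdf_def measure_def)
qed

text \<open>A point strictly below \<open>p\<close> lies below the infimum defining the quantile, so
  the tail there cannot reach \<open>\<delta>\<close>. The point \<open>p\<close> may itself be the
  quantile, so the bound at \<open>p\<close> comes from continuity from the left.\<close>

lemma binomial_tail_le_of_beta_quantile:
  assumes k: "1 \<le> k" "k \<le> n" and p: "0 < p" "p < 1" and "0 < \<delta>"
    and q: "p \<le> quantile (beta_distribution (real k) (real (n + 1 - k))) \<delta>"
  shows "binomial_tail n k p \<le> \<delta>"
proof -
  let ?A = "{x. \<delta> \<le> cdf (beta_distribution (real k) (real (n + 1 - k))) x}"
  have bdd: "bdd_below ?A"
  proof (rule bdd_belowI)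
    fix x assume "x \<in> ?A"
    then show "0 \<le> x"
      using \<open>0 < \<delta>\<close> cdf_beta_distribution_nonpos[of x] by (cases "x \<le> 0") auto
  qed
  have below: "binomial_tail n k x \<le> \<delta>" if "0 < x" "x < p" for x
  proof (rule ccontr)
    assume "\<not> ?thesis"
    then have "x \<in> ?A" using that p cdf_beta_distribution_eq_binomial_tail[OF k, of x] by simp
    from cInf_lower[OF this bdd] show False using q that by (simp add: quantile_def)
  qed
  have "isCont (binomial_tail n k) p" using DERIV_binomial_tail[OF k] by (rule DERIV_isCont)
  then have "(binomial_tail n k \<longlongrightarrow> binomial_tail n k p) (at_left p)"
    by (simp add: isCont_def filterlim_at_split)
  moreover have "eventually (\<lambda>x. binomial_tail n k x \<le> \<delta>) (at_left p)"
    using eventually_at_left_real[OF p(1)] by eventually_elim (auto intro: below)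
  ultimately show ?thesis by (rule tendsto_upperbound) simp
qed

section \<open>Independent trials and levels of a distribution function\<close>

text \<open>The event is split by the exact set \<open>J\<close> of successful indices. Independence
  gives the probability of each pattern, and grouping the patterns by cardinality produces the
  binomial coefficients.\<close>

lemma (in prob_space) prob_card_ge_eq_binomial_tail:
  fixes X :: "'i \<Rightarrow> 'a \<Rightarrow> 'b"
  assumes ind: "indep_vars (\<lambda>_. N) X I" and I: "finite I"
    and A: "A \<in> sets N" and r: "\<And>i. i \<in> I \<Longrightarrow> prob (X i -` A \<inter> space M) = r"
  shows "prob {\<omega>\<in>space M. k \<le> card {i\<in>I. X i \<omega> \<in> A}} = binomial_tail (card I) k r"
proof -
  have X: "i \<in> I \<Longrightarrow> X i \<in> measurable M N" for i using ind by (auto simp: indep_vars_def)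
  have XN: "i \<in> I \<Longrightarrow> \<omega> \<in> space M \<Longrightarrow> X i \<omega> \<in> space N" for i \<omega> using measurable_space[OF X] .
  define G where "G J = {\<omega>\<in>space M. {i\<in>I. X i \<omega> \<in> A} = J}" for J
  have r': "prob (X i -` (space N - A) \<inter> space M) = 1 - r" if "i \<in> I" for i
  proof -
    have "X i -` (space N - A) \<inter> space M = space M - (X i -` A \<inter> space M)"
      using XN[OF that] by auto
    then show ?thesis using prob_compl[of "X i -` A \<inter> space M"] r[OF that] measurable_sets[OF X[OF that] A]
      by simp
  qed
  define B where "B J i = (if i \<in> J then A else space N - A)" for J :: "'i set" and i
  \<comment> \<open>An intersection over an empty index set would be \<open>UNIV\<close> instead of
    \<open>space M\<close>, hence the separate case.\<close>
  have GB: "G J = (if I = {} then space M else \<Inter>i\<in>I. X i -` B J i \<inter> space M)" if "J \<subseteq> I" for J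
    using that XN by (auto simp: G_def B_def split: if_splits)
  have G_sets: "G J \<in> events" if "J \<subseteq> I" for J
  proof (cases "I = {}")
    case False
    have "(\<Inter>i\<in>I. X i -` B J i \<inter> space M) \<in> events"
      using A by (intro sets.finite_INT I False measurable_sets[OF X]) (auto simp: B_def)
    then show ?thesis unfolding GB[OF that] using False by simp
  qed (simp add: GB[OF that])
  have probG: "prob (G J) = r ^ card J * (1 - r) ^ (card I - card J)" if J: "J \<subseteq> I" for J
  proof (cases "I = {}")
    case True
    then show ?thesis using GB[OF J] J by (simp add: prob_space)
  next
    case False
    have "prob (G J) = (\<Prod>i\<in>I. prob (X i -` B J i \<inter> space M))"
      using indep_varsD_finite[OF ind False I, of "B J"] A by (simp add: GB[OF J] False B_def)
    also have "\<dots> = (\<Prod>i\<in>I. if i \<in> J then r else 1 - r)"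
      by (intro prod.cong) (auto simp: B_def r r')
    also have "\<dots> = r ^ card J * (1 - r) ^ card (I - J)"
      using J I by (simp add: prod.If_cases Int_absorb1 Diff_eq)
    finally show ?thesis using J I by (simp add: card_Diff_subset finite_subset)
  qed
  let ?K = "{J. J \<subseteq> I \<and> k \<le> card J}"
  have "{\<omega>\<in>space M. k \<le> card {i\<in>I. X i \<omega> \<in> A}} = (\<Union>J\<in>?K. G J)"
    by (auto simp: G_def)
  moreover have "prob (\<Union>J\<in>?K. G J) = (\<Sum>J\<in>?K. prob (G J))"
    using I G_sets by (intro finite_measure_finite_Union) (auto simp: disjoint_family_on_def G_def)
  moreover have "\<dots> = (\<Sum>J\<in>?K. r ^ card J * (1 - r) ^ (card I - card J))"
    by (intro sum.cong) (auto simp: probG)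
  moreover have "\<dots> = (\<Sum>j\<in>{k..card I}. \<Sum>J\<in>{J\<in>?K. card J = j}. r ^ card J * (1 - r) ^ (card I - card J))"
    using I by (intro sum.group[symmetric]) (auto intro: card_mono)
  moreover have "\<dots> = (\<Sum>j\<in>{k..card I}. \<Sum>J\<in>{J. J \<subseteq> I \<and> card J = j}. r ^ j * (1 - r) ^ (card I - j))"
    by (intro sum.cong) auto
  moreover have "\<dots> = binomial_tail (card I) k r"
    using I by (simp add: binomial_tail_def n_subsets mult_ac)
  ultimately show ?thesis by simp
qed

text \<open>The set is a ray ending at its supremum \<open>s\<close>. If it contains
  \<open>s\<close>, its probability is \<open>cdf M s\<close>, which is below \<open>p\<close>;
  otherwise it is the left limit of \<open>cdf M\<close> at \<open>s\<close>, hence at most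
  \<open>p\<close>. A jump at \<open>s\<close> can make the inequality strict.\<close>

lemma (in real_distribution) prob_cdf_less_le:
  assumes "0 < p" "p < 1"
  shows "prob {x. cdf M x < p} \<le> p"
proof (cases "{x. cdf M x < p} = {}")
  case True
  then show ?thesis using assms by simp
next
  case False
  let ?A = "{x. cdf M x < p}"
  \<comment> \<open>As \<open>p < 1\<close>, the distribution function eventually exceeds
    \<open>p\<close>, so the ray is bounded above and \<open>Sup\<close> is meaningful.\<close>
  have "eventually (\<lambda>x. p < cdf M x) at_top"
    using cdf_lim_at_top_prob assms(2) by (rule order_tendstoD)
  then obtain b where b: "\<And>x. b \<le> x \<Longrightarrow> p < cdf M x" by (auto simp: eventually_at_top_linorder)
  have bdd: "bdd_above ?A"
  proof (rule bdd_aboveI)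
    fix x assume "x \<in> ?A"
    then show "x \<le> b" using b[of x] by (cases "b \<le> x") auto
  qed
  define s where "s = Sup ?A"
  have upper: "x \<le> s" if "cdf M x < p" for x unfolding s_def using that bdd by (intro cSup_upper) auto
  have lower: "cdf M x < p" if "x < s" for x
  proof -
    from that obtain y where "cdf M y < p" "x < y"
      unfolding s_def using less_cSup_iff[OF False bdd] by auto
    then show ?thesis using cdf_nondecreasing[of x y] by simp
  qed
  show ?thesis
  proof (cases "cdf M s < p")
    case True
    then have "cdf M x < p" if "x \<le> s" for x using lower[of x] that by (cases "x = s") auto
    then have "?A = {..s}" using upper by auto
    then show ?thesis using True by (simp add: cdf_def)
  next
    case F: False
    have "x < s" if "cdf M x < p" for x using upper[OF that] that F by (cases "x = s") auto
    then have "?A = {..<s}" using lower by auto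
    moreover have "prob {..<s} \<le> p"
    proof (rule tendsto_upperbound[OF cdf_at_left])
      show "eventually (\<lambda>x. cdf M x \<le> p) (at_left s)"
        by (rule eventually_at_leftI[of "s - 1"]) (auto dest: lower)
    qed simp
    ultimately show ?thesis by simp
  qed
qed

section \<open>Conditioning on an independent variable\<close>

lemma subalgebra_vimage_algebra:
  assumes "f \<in> measurable M N"
  shows "subalgebra M (vimage_algebra (space M) f N)"
  unfolding subalgebra_def using assms
  by (auto simp: sets_vimage_algebra2 measurable_space)

text \<open>Freezing lemma: by independence the joint law is a product, so Fubini lets
  \<open>Z\<close> be integrated out under its own law with \<open>Y\<close> held fixed.\<close>

lemma (in prob_space) real_cond_exp_indep_var:
  assumes ind: "indep_var S Y T Z"
    and h[measurable]: "h \<in> borel_measurable (S \<Otimes>\<^sub>M T)"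
    and int: "integrable M (\<lambda>\<omega>. h (Y \<omega>, Z \<omega>))"
  shows "AE \<omega> in M. real_cond_exp M (vimage_algebra (space M) Y S) (\<lambda>\<omega>. h (Y \<omega>, Z \<omega>)) \<omega>
           = (\<integral>z. h (Y \<omega>, z) \<partial>distr M T Z)"
proof -
  have Y[measurable]: "Y \<in> measurable M S" and Z[measurable]: "Z \<in> measurable M T"
    and distr: "distr M S Y \<Otimes>\<^sub>M distr M T Z = distr M (S \<Otimes>\<^sub>M T) (\<lambda>x. (Y x, Z x))"
    using ind by (simp_all add: indep_var_distribution_eq)
  interpret PY: prob_space "distr M S Y" by (rule prob_space_distr) fact
  interpret PZ: prob_space "distr M T Z" by (rule prob_space_distr) fact
  interpret P: pair_prob_space "distr M S Y" "distr M T Z" ..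
  let ?G = "vimage_algebra (space M) Y S"
  have sub: "subalgebra M ?G"
    by (rule subalgebra_vimage_algebra[OF Y])
  interpret finite_measure_subalgebra M ?G by unfold_locales fact
  define g where "g y = (\<integral>z. h (y, z) \<partial>distr M T Z)" for y
  have g[measurable]: "g \<in> borel_measurable S"
    unfolding g_def by measurable
  have YG: "Y \<in> measurable ?G S"
    using measurable_space[OF Y] by (intro measurable_vimage_algebra1) auto
  have inth: "integrable (distr M S Y \<Otimes>\<^sub>M distr M T Z) h"
    unfolding distr using int by (subst integrable_distr_eq) auto
  have "integrable (distr M S Y) g"
    unfolding g_def using P.integrable_fst'[OF inth] by simp
  then have intg: "integrable M (\<lambda>\<omega>. g (Y \<omega>))"
    by (subst (asm) integrable_distr_eq) auto
  have "AE \<omega> in M. real_cond_exp M ?G (\<lambda>\<omega>. h (Y \<omega>, Z \<omega>)) \<omega> = g (Y \<omega>)"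
  proof (rule real_cond_exp_charact)
    fix A assume "A \<in> sets ?G"
    \<comment> \<open>Each set of the generated algebra is a preimage under \<open>Y\<close>, so
      restricting to it becomes a factor in the first coordinate alone, which leaves the inner
      integral.\<close>
    then obtain B where B[measurable]: "B \<in> sets S" and A: "A = Y -` B \<inter> space M"
      using measurable_space[OF Y] by (auto simp: sets_vimage_algebra2)
    have "(\<integral>\<omega>\<in>A. h (Y \<omega>, Z \<omega>) \<partial>M) = (\<integral>\<omega>. indicator B (Y \<omega>) * h (Y \<omega>, Z \<omega>) \<partial>M)"
      unfolding set_lebesgue_integral_def by (intro Bochner_Integration.integral_cong) (auto simp: A indicator_def)
    also have "\<dots> = (\<integral>x. indicator B (fst x) * h x \<partial>(distr M S Y \<Otimes>\<^sub>M distr M T Z))"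
      unfolding distr by (subst integral_distr) auto
    also have "\<dots> = (\<integral>y. (\<integral>z. indicator B y * h (y, z) \<partial>distr M T Z) \<partial>distr M S Y)"
    proof (subst P.integral_fst'[symmetric])
      show "integrable (distr M S Y \<Otimes>\<^sub>M distr M T Z) (\<lambda>x. indicator B (fst x) * h x)"
        by (rule Bochner_Integration.integrable_bound[OF inth]) (auto simp: indicator_def)
    qed simp
    also have "\<dots> = (\<integral>y. indicator B y * g y \<partial>distr M S Y)"
      by (simp add: g_def)
    also have "\<dots> = (\<integral>\<omega>. indicator B (Y \<omega>) * g (Y \<omega>) \<partial>M)"
      by (subst integral_distr) auto
    also have "\<dots> = (\<integral>\<omega>\<in>A. g (Y \<omega>) \<partial>M)"
      unfolding set_lebesgue_integral_def by (intro Bochner_Integration.integral_cong) (auto simp: A indicator_def)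
    finally show "(\<integral>\<omega>\<in>A. h (Y \<omega>, Z \<omega>) \<partial>M) = (\<integral>\<omega>\<in>A. g (Y \<omega>) \<partial>M)" .
  qed (use int intg measurable_compose[OF YG g] in auto)
  then show ?thesis by (simp add: g_def)
qed

section \<open>Scores and misdetection\<close>

text \<open>Monotonicity makes the covering scales upward closed, and the assumed minimum makes them
  a closed ray starting at the score.\<close>

lemma nonconformity_score_le_iff:
  assumes "has_minimum (covering_scales S occ pred e)"
    and mono: "\<And>s q q'. s \<in> S \<Longrightarrow> q \<le> q' \<Longrightarrow> pred s e q \<subseteq> pred s e q'"
  shows "nonconformity_score S occ pred e \<le> q \<longleftrightarrow> q \<in> covering_scales S occ pred e"
proof -
  obtain m where m: "m \<in> covering_scales S occ pred e"
      "\<And>q. q \<in> covering_scales S occ pred e \<Longrightarrow> m \<le> q"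
    using assms(1) by (auto simp: has_minimum_def)
  then have "nonconformity_score S occ pred e = m"
    unfolding nonconformity_score_def by (intro Least_equality)
  moreover have "q \<in> covering_scales S occ pred e" if "m \<le> q"
    using m(1) mono[OF _ that] unfolding covering_scales_def by blast
  ultimately show ?thesis using m(2) by blast
qed

text \<open>Reduces the geometry of occupied spaces to a comparison of two reals. The inequality is
  strict because the scale equal to the score already covers.\<close>

lemma misdetection_cost_calibrated:
  assumes "finite S" and min: "has_minimum (covering_scales S occ pred e)"
    and mono: "\<And>s q q'. s \<in> S \<Longrightarrow> q \<le> q' \<Longrightarrow> pred s e q \<subseteq> pred s e q'"
  shows "misdetection_cost S occ (calibrated pred q) e
           = indicator {q<..} (nonconformity_score S occ pred e)"
proof -
  \<comment> \<open>With no states every real would be a covering scale, and the minimum could not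
    exist. Nonemptiness keeps \<open>Max\<close> meaningful.\<close>
  have "S \<noteq> {}"
  proof
    assume "S = {}"
    then obtain m :: real where "\<forall>q. m \<le> q"
      using min by (auto simp: has_minimum_def covering_scales_def)
    then have "m \<le> m - 1" by blast
    then show False by simp
  qed
  show ?thesis
  proof (cases "q \<in> covering_scales S occ pred e")
    case True
    then have "(\<lambda>s. of_bool (\<not> occ e \<subseteq> calibrated pred q s e)) ` S = {0 :: real}"
      using \<open>S \<noteq> {}\<close> by (auto simp: covering_scales_def calibrated_def)
    then show ?thesis
      using True nonconformity_score_le_iff[OF min mono, of q]
      by (auto simp: misdetection_cost_def indicator_def)
  next
    case False
    then have "1 \<in> (\<lambda>s. of_bool (\<not> occ e \<subseteq> calibrated pred q s e) :: real) ` S"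
      by (force simp: covering_scales_def calibrated_def)
    then have "misdetection_cost S occ (calibrated pred q) e = 1"
      unfolding misdetection_cost_def using \<open>finite S\<close> by (intro Max_eqI) auto
    then show ?thesis
      using False nonconformity_score_le_iff[OF min mono, of q]
      by (auto simp: indicator_def)
  qed
qed

section \<open>Measurability and coverage of the empirical quantile\<close>

text \<open>A sublevel set says that at least \<open>k\<close> coordinates are at most
  \<open>a\<close>, and this count is a finite sum of measurable indicators.\<close>

lemma borel_measurable_kth_smallest:
  assumes k: "1 \<le> k" "k \<le> N"
  shows "kth_smallest N k \<in> borel_measurable (\<Pi>\<^sub>M i\<in>{1..N}. borel)"
proof (rule borel_measurable_iff_le[THEN iffD2], intro allI)
  fix a
  have "{w \<in> space (\<Pi>\<^sub>M i\<in>{1..N}. (borel :: real measure)). kth_smallest N k w \<le> a}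
      = {w \<in> space (\<Pi>\<^sub>M i\<in>{1..N}. borel). real k \<le> (\<Sum>i\<in>{1..N}. indicator {..a} (w i))}"
    using kth_smallest_iff_card[of "\<lambda>x. x \<le> a", OF _ k]
    by (auto simp: indicator_def sum.If_cases Int_def)
  also have "\<dots> \<in> sets (\<Pi>\<^sub>M i\<in>{1..N}. borel)" by measurable
  finally show "{w \<in> space (\<Pi>\<^sub>M i\<in>{1..N}. borel). kth_smallest N k w \<le> a} \<in> \<dots>" .
qed

text \<open>The count of scores in the ray \<open>cdf L x < p\<close> is binomial with the exact
  mass of that ray. Since jumps allow a mass below \<open>p\<close>, monotonicity of the tail is
  needed before the Beta bound applies.\<close>

lemma (in prob_space) prob_cdf_kth_smallest_ge:
  assumes ind: "indep_vars (\<lambda>_. borel) V {1..N}"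
    and distr: "\<And>i. i \<in> {1..N} \<Longrightarrow> distr M borel (V i) = L" and L: "real_distribution L"
    and k: "1 \<le> k" "k \<le> N" and p: "0 < p" "p < 1" and "0 < \<delta>"
    and q: "p \<le> quantile (beta_distribution (real k) (real (N + 1 - k))) \<delta>"
  shows "1 - \<delta> \<le> prob {\<omega>\<in>space M. p \<le> cdf L (kth_smallest N k (\<lambda>i. V i \<omega>))}"
proof -
  interpret L: real_distribution L by fact
  have V: "i \<in> {1..N} \<Longrightarrow> V i \<in> borel_measurable M" for i using ind by (auto simp: indep_vars_def)
  have [measurable]: "cdf L \<in> borel_measurable borel"
    by (intro borel_measurable_mono monoI L.cdf_nondecreasing)
  let ?A = "{x. cdf L x < p}"
  have A: "?A \<in> sets borel" by measurable
  have r: "prob (V i -` ?A \<inter> space M) = measure L ?A" if "i \<in> {1..N}" for i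
    using distr[OF that] measure_distr[OF V[OF that] A] by simp
  have eq: "{\<omega>\<in>space M. cdf L (kth_smallest N k (\<lambda>i. V i \<omega>)) < p}
      = {\<omega>\<in>space M. k \<le> card {i\<in>{1..N}. V i \<omega> \<in> ?A}}"
    by (subst kth_smallest_iff_card[of "\<lambda>x. cdf L x < p", OF _ k])
      (auto intro: le_less_trans L.cdf_nondecreasing)
  have "prob {\<omega>\<in>space M. cdf L (kth_smallest N k (\<lambda>i. V i \<omega>)) < p} = binomial_tail N k (measure L ?A)"
    unfolding eq using prob_card_ge_eq_binomial_tail[OF ind _ A r, of k] by simp
  also have "\<dots> \<le> binomial_tail N k p"
    using L.prob_cdf_less_le[OF p] p by (intro binomial_tail_mono k) auto
  also have "\<dots> \<le> \<delta>"
    using binomial_tail_le_of_beta_quantile[OF k p \<open>0 < \<delta>\<close> q] .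
  finally have le: "prob {\<omega>\<in>space M. cdf L (kth_smallest N k (\<lambda>i. V i \<omega>)) < p} \<le> \<delta>" .
  have "(\<lambda>\<omega>. kth_smallest N k (\<lambda>i\<in>{1..N}. V i \<omega>)) \<in> borel_measurable M"
    using V by (intro measurable_compose[OF measurable_restrict borel_measurable_kth_smallest[OF k]]) auto
  \<comment> \<open>Only the indices from 1 to \<open>N\<close> are read, so passing to the
    restricted function, a point of the product space, changes nothing.\<close>
  moreover have "kth_smallest N k (\<lambda>i\<in>{1..N}. V i \<omega>) = kth_smallest N k (\<lambda>i. V i \<omega>)" for \<omega>
    unfolding kth_smallest_def by (auto intro!: arg_cong[where f = "\<lambda>xs. sort xs ! _"])
  ultimately have [measurable]: "(\<lambda>\<omega>. kth_smallest N k (\<lambda>i. V i \<omega>)) \<in> borel_measurable M" by simp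
  have "prob (space M - {\<omega>\<in>space M. cdf L (kth_smallest N k (\<lambda>i. V i \<omega>)) < p})
      = 1 - prob {\<omega>\<in>space M. cdf L (kth_smallest N k (\<lambda>i. V i \<omega>)) < p}"
    by (intro prob_compl) measurable
  moreover have "space M - {\<omega>\<in>space M. cdf L (kth_smallest N k (\<lambda>i. V i \<omega>)) < p}
      = {\<omega>\<in>space M. p \<le> cdf L (kth_smallest N k (\<lambda>i. V i \<omega>))}"
    by auto
  ultimately show ?thesis using le by simp
qed

section \<open>The misdetection bound\<close>

theorem proposition1:
  fixes S :: "'s set"
    and D :: "'e measure"
    and X :: "'e \<Rightarrow> 'x set"
    and occ :: "'e \<Rightarrow> 'x set"
    and pred :: "('s, 'e, 'x) scaled_perception"
    and M :: "'w measure"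
    and E :: "nat \<Rightarrow> 'w \<Rightarrow> 'e"
    and E_test :: "'w \<Rightarrow> 'e"
    and N v :: nat
    and \<epsilon> \<delta> \<epsilon>_hat :: real
    and U :: "'e \<Rightarrow> real"
    and q_hat :: "'w \<Rightarrow> real"
  assumes "finite S"
    and "prob_space D"
    and "\<And>e. e \<in> space D \<Longrightarrow> occ e \<subseteq> X e"
    and "\<And>s e q. s \<in> S \<Longrightarrow> e \<in> space D \<Longrightarrow> pred s e q \<subseteq> X e"
    and "\<And>s e q q'. s \<in> S \<Longrightarrow> e \<in> space D \<Longrightarrow> q \<le> q' \<Longrightarrow> pred s e q \<subseteq> pred s e q'"
    and "\<And>e. e \<in> space D \<Longrightarrow> has_minimum (covering_scales S occ pred e)"
    and U_def: "U = nonconformity_score S occ pred"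
    and "U \<in> borel_measurable D"
    and "prob_space M"
    and "prob_space.indep_vars M (\<lambda>_. D) E {1..Suc N}"
    and "\<And>i. i \<in> {1..Suc N} \<Longrightarrow> distr M D (E i) = D"
    and E_test_def: "E_test = E (Suc N)"
    and "0 < \<epsilon>" "\<epsilon> < 1" "0 < \<delta>" "\<delta> < 1"
    and "int v = \<lfloor>(real N + 1) * \<epsilon>_hat\<rfloor>"
    and "1 \<le> v" "v \<le> N"
    and "quantile (beta_distribution (real N + 1 - real v) (real v)) \<delta> \<ge> 1 - \<epsilon>"
    and q_hat_def: "q_hat = (\<lambda>\<omega>. kth_smallest N (nat \<lceil>(real N + 1) * (1 - \<epsilon>_hat)\<rceil>) (\<lambda>i. U (E i \<omega>)))"
  shows "measure M {\<omega> \<in> space M.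
           real_cond_exp M (generated_algebra M {1..N} (\<lambda>i \<omega>'. U (E i \<omega>')))
             (\<lambda>\<omega>'. misdetection_cost S occ (calibrated pred (q_hat \<omega>')) (E_test \<omega>')) \<omega> \<le> \<epsilon>}
         \<ge> 1 - \<delta>"
proof -
  interpret M: prob_space M by fact
  note ind = assms(10) and distrE = assms(11) and U[measurable] = assms(8)
  define k where "k = N + 1 - v"
  have k: "1 \<le> k" "k \<le> N" and v: "v = N + 1 - k" using \<open>1 \<le> v\<close> \<open>v \<le> N\<close> by (auto simp: k_def)
  \<comment> \<open>The ceiling of an integer minus \<open>x\<close> is that integer minus the floor
    of \<open>x\<close>; this turns the rank into \<open>N + 1 - v\<close>.\<close>
  have "\<lceil>(real N + 1) * (1 - \<epsilon>_hat)\<rceil> = \<lceil>real (N + 1) - (real N + 1) * \<epsilon>_hat\<rceil>"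
    by (simp add: algebra_simps)
  also have "\<dots> = int (N + 1) - \<lfloor>(real N + 1) * \<epsilon>_hat\<rfloor>"
    by linarith
  finally have nat_k: "nat \<lceil>(real N + 1) * (1 - \<epsilon>_hat)\<rceil> = k"
    using \<open>int v = _\<close> by (simp add: k_def nat_diff_distrib')
  have beta: "beta_distribution (real N + 1 - real v) (real v) = beta_distribution (real k) (real (N + 1 - k))"
    using k by (simp add: v of_nat_diff)

  have E: "E i \<in> measurable M D" if "i \<in> {1..Suc N}" for i
    using ind that by (auto simp: M.indep_vars_def)
  define V where "V = (\<lambda>i \<omega>. U (E i \<omega>))"
  have indV: "M.indep_vars (\<lambda>_. borel) V {1..Suc N}"
    unfolding V_def using M.indep_vars_compose2[OF ind, of "\<lambda>_. U" "\<lambda>_. borel"] by simp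
  define L where "L = distr D borel U"
  interpret D: prob_space D by fact
  have L: "real_distribution L" unfolding L_def by (rule D.real_distribution_distr) fact
  interpret L: real_distribution L by fact
  have distrV: "distr M borel (V i) = L" if "i \<in> {1..Suc N}" for i
    using distr_distr[OF U E[OF that]] distrE[OF that] by (simp add: L_def V_def comp_def)

  \<comment> \<open>Calibration scores and test score become two independent blocks.
    \<open>Z\<close> is a vector with one coordinate because block independence is stated for
    product spaces.\<close>
  define Y where "Y = (\<lambda>\<omega>. \<lambda>i\<in>{1..N}. V i \<omega>)"
  define Z where "Z = (\<lambda>\<omega>. \<lambda>i\<in>{Suc N}. V i \<omega>)"
  have indY: "M.indep_var (\<Pi>\<^sub>M i\<in>{1..N}. borel) Y (\<Pi>\<^sub>M i\<in>{Suc N}. borel) Z"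
    unfolding Y_def Z_def by (rule M.indep_var_restrict[OF indV]) auto
  have [measurable]: "kth_smallest N k \<in> borel_measurable (\<Pi>\<^sub>M i\<in>{1..N}. borel)"
    by (rule borel_measurable_kth_smallest[OF k])
  define h where "h = (\<lambda>(y, z). indicator {kth_smallest N k y<..} (z (Suc N)) :: real)"
  have h_eq: "h = (\<lambda>x. if kth_smallest N k (fst x) < snd x (Suc N) then 1 else 0)"
    by (auto simp: h_def fun_eq_iff indicator_def)
  have h[measurable]: "h \<in> borel_measurable ((\<Pi>\<^sub>M i\<in>{1..N}. borel) \<Otimes>\<^sub>M (\<Pi>\<^sub>M i\<in>{Suc N}. borel))"
    unfolding h_eq by measurable
  have Ym[measurable]: "Y \<in> measurable M (\<Pi>\<^sub>M i\<in>{1..N}. borel)"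
    and Zm[measurable]: "Z \<in> measurable M (\<Pi>\<^sub>M i\<in>{Suc N}. borel)"
    using indY by (simp_all add: M.indep_var_distribution_eq)
  have int_h: "integrable M (\<lambda>\<omega>. h (Y \<omega>, Z \<omega>))"
    by (rule M.integrable_const_bound[of _ 1]) (auto simp: h_def indicator_def)
  have q_Y: "q_hat \<omega> = kth_smallest N k (Y \<omega>)" for \<omega>
    unfolding q_hat_def nat_k kth_smallest_def Y_def V_def
    by (auto intro!: arg_cong[where f = "\<lambda>xs. sort xs ! _"])
  let ?G = "generated_algebra M {1..N} (\<lambda>i \<omega>'. U (E i \<omega>'))"
  let ?C = "\<lambda>\<omega>'. misdetection_cost S occ (calibrated pred (q_hat \<omega>')) (E_test \<omega>')"
  have G: "?G = vimage_algebra (space M) Y (\<Pi>\<^sub>M i\<in>{1..N}. borel)"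
    by (simp add: generated_algebra_def Y_def V_def)
  have C: "?C \<omega> = h (Y \<omega>, Z \<omega>)" if "\<omega> \<in> space M" for \<omega>
  proof -
    have "E_test \<omega> \<in> space D" using measurable_space[OF E that, of "Suc N"] by (simp add: E_test_def)
    then show ?thesis
      using misdetection_cost_calibrated[OF assms(1,6), of "E_test \<omega>" "q_hat \<omega>"] assms(5)
      by (simp add: h_def V_def Z_def U_def q_Y E_test_def)
  qed
  have sub: "subalgebra M ?G"
    unfolding G by (rule subalgebra_vimage_algebra[OF Ym])
  interpret finite_measure_subalgebra M ?G by unfold_locales fact
  \<comment> \<open>With the calibration scores frozen, the threshold is a constant and the expected
    cost is the mass of \<open>L\<close> strictly above it.\<close>
  have miss: "(\<integral>z. h (Y \<omega>, z) \<partial>distr M (\<Pi>\<^sub>M i\<in>{Suc N}. borel) Z) = 1 - cdf L (q_hat \<omega>)" for \<omega>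
  proof -
    have "(\<integral>z. h (Y \<omega>, z) \<partial>distr M (\<Pi>\<^sub>M i\<in>{Suc N}. borel) Z)
        = (\<integral>\<omega>'. indicator {q_hat \<omega><..} (V (Suc N) \<omega>') \<partial>M)"
      by (subst integral_distr[OF Zm]) (auto simp: h_def q_Y Z_def)
    also have "\<dots> = (\<integral>x. indicator {q_hat \<omega><..} x \<partial>distr M borel (V (Suc N)))"
      using indV by (subst integral_distr) (auto simp: M.indep_vars_def)
    also have "\<dots> = measure L (UNIV - {..q_hat \<omega>})"
      using distrV[of "Suc N"] by (simp add: Compl_eq_Diff_UNIV[symmetric])
    finally show ?thesis
      using L.prob_compl[of "{..q_hat \<omega>}"] by (simp add: cdf_def)
  qed
  \<comment> \<open>The cost is known to equal \<open>h\<close> only on \<open>space M\<close>,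
    where environments lie in \<open>space D\<close>; its measurability is inherited from
    \<open>h\<close>.\<close>
  have "AE \<omega> in M. real_cond_exp M ?G ?C \<omega> = real_cond_exp M ?G (\<lambda>\<omega>. h (Y \<omega>, Z \<omega>)) \<omega>"
  proof (rule real_cond_exp_cong)
    show "?C \<in> borel_measurable M"
      by (subst measurable_cong[OF C]) measurable
  qed (auto simp: C)
  moreover have "AE \<omega> in M. real_cond_exp M ?G (\<lambda>\<omega>. h (Y \<omega>, Z \<omega>)) \<omega>
      = (\<integral>z. h (Y \<omega>, z) \<partial>distr M (\<Pi>\<^sub>M i\<in>{Suc N}. borel) Z)"
    unfolding G by (rule M.real_cond_exp_indep_var[OF indY h int_h])
  ultimately have AE: "AE \<omega> in M. real_cond_exp M ?G ?C \<omega> = 1 - cdf L (q_hat \<omega>)"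
    by eventually_elim (simp add: miss)

  have "1 - \<delta> \<le> measure M {\<omega>\<in>space M. 1 - \<epsilon> \<le> cdf L (kth_smallest N k (\<lambda>i. V i \<omega>))}"
  proof (rule M.prob_cdf_kth_smallest_ge[OF _ _ L k])
    show "M.indep_vars (\<lambda>_. borel) V {1..N}"
      using indV by (rule M.indep_vars_subset) auto
    show "distr M borel (V i) = L" if "i \<in> {1..N}" for i
      using distrV that by simp
    show "1 - \<epsilon> \<le> quantile (beta_distribution (real k) (real (N + 1 - k))) \<delta>"
      using assms(20) unfolding beta .
  qed (use \<open>0 < \<epsilon>\<close> \<open>\<epsilon> < 1\<close> \<open>0 < \<delta>\<close> in auto)
  also have "\<dots> = measure M {\<omega>\<in>space M. 1 - \<epsilon> \<le> cdf L (q_hat \<omega>)}"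
    unfolding q_hat_def nat_k V_def ..
  \<comment> \<open>The conditional expectation is identified only almost everywhere, so the events
    are compared up to a null set.\<close>
  also have "\<dots> \<le> measure M {\<omega>\<in>space M. real_cond_exp M ?G ?C \<omega> \<le> \<epsilon>}"
  proof (rule M.finite_measure_mono_AE)
    show "AE \<omega> in M. \<omega> \<in> {\<omega>\<in>space M. 1 - \<epsilon> \<le> cdf L (q_hat \<omega>)} \<longrightarrow>
        \<omega> \<in> {\<omega>\<in>space M. real_cond_exp M ?G ?C \<omega> \<le> \<epsilon>}"
      using AE by eventually_elim auto
    show "{\<omega>\<in>space M. real_cond_exp M ?G ?C \<omega> \<le> \<epsilon>} \<in> M.events"
      using borel_measurable_cond_exp2 by measurable
  qed
  finally show ?thesis .
qed

end
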